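(* Consider a partition $\mathcal{X}_N=\{D_1,\ldots,D_N\}$ of the state space $X$ with attractor set $\mathcal{A}\subseteq D_N$ and a quantization $\mathcal{U}_M=\{u^1,\ldots,u^M\}$ of the control space $U$, with associated sub-Markov matrices $P^1_{T_1},\ldots,P^1_{T_M}\in\mathbb{R}^{(N-1)\times(N-1)}$. Let $m\in\mathbb{R}^{N-1}$ and $G^1,\ldots,G^M\in\mathbb{R}^{N-1}$ have strictly positive entries. Suppose that for some $\gamma>1$ the linear program $$\text{(P)}\qquad \min_{\theta^1,\ldots,\theta^M\ge 0}\ \sum_{a=1}^M (G^a)'\theta^a\quad\text{s.t.}\quad \gamma\sum_{a=1}^M (P^1_{T_a})'\theta^a-\sum_{a=1}^M\theta^a=-m$$ is feasible, and let $$\text{(D)}\qquad \max_{V\in\mathbb{R}^{N-1}}\ m'V\quad\text{s.t.}\quad V\le \gamma P^1_{T_a}V+G^a\quad\forall a=1,\ldots,M$$ be its dual. Then, for this $\gamma$: 1) There exist a bounded optimal solution $\theta=(\theta^1,\ldots,\theta^M)$ of (P) and a bounded optimal solution $V$ of (D). 2) An optimal control on each set $D_j$, $j=1,\ldots,N-1$, is given by $u(D_j)=u^{a(j)}$, where $a(j):=\min\{a:(\theta^a)_j>0\}$ (in particular this set is nonempty for every $j$). 3) Define $P^1_{T_u}\in\mathbb{R}^{(N-1)\times(N-1)}$ by $(P^1_{T_u})_{ji}=(P^1_{T_{a(j)}})_{ji}$ for $1\le i,j\le N-1$. The equation $\gamma (P^1_{T_u})'\mu-\mu=-m$ has a unique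 solution $\mu\in\mathbb{R}^{N-1}$, and $\mu$ is the Lyapunov measure for the controlled system.
   Context: Setting. $X\subset\mathbb{R}^q$ and $U\subset\mathbb{R}^d$ are compact, $T:X\times U\to X$ is a (measurable) controlled map, and $\mathcal{A}\subset X$ is the attractor set. $\mathcal{X}_N=\{D_1,\ldots,D_N\}$ is a finite partition of $X$ into measurable cells of positive Lebesgue measure with $\mathcal{A}\subseteq D_N$; $\mathcal{U}_M=\{u^1,\ldots,u^M\}\subset U$ is a finite set of control values. For each $a$ let $T_a(x)=T(x,u^a)$ and let $P_{T_a}\in\mathbb{R}^{N\times N}$ be the row-stochastic matrix $(P_{T_a})_{ij}=\lambda(T_a^{-1}(D_j)\cap D_i)/\lambda(D_i)$, with $\lambda$ Lebesgue measure. $P^1_{T_a}\in\mathbb{R}^{(N-1)\times(N-1)}$ consists of the first $N-1$ rows and columns of $P_{T_a}$. $G^a\in\mathbb{R}^{N-1}$ is a cost vector, $(G^a)_j$ being the cost of using control $u^a$ on $D_j$; $m\in\mathbb{R}^{N-1}$ is a vector representing a measure on the cells $D_1,\ldots,D_{N-1}$. The unknowns $\theta^a$ are vectors in $\mathbb{R}^{N-1}$. A prime $'$ denotes transpose and vector inequalities are componentwise. Optimal control. A control assignment $u(D_j)=u^{a(j)}$, $j=1,\ldots,N-1$, is optimal if (P) has an optimal solution $\tilde\theta$ with $(\tilde\theta^{a})_j=0$ for all $j$ and all $a\neq a(j)$, so that all mass on each cell $D_j$ uses the single control $u^{a(j)}$. Lyapunov measure. For a control assignment $u$ with closed-loop sub-Markov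 matrix $P^1_{T_u}$ (row $j$ equal to row $j$ of $P^1_{T_{a(j)}}$), a Lyapunov measure is a (finite) vector $\mu\in\mathbb{R}^{N-1}$, $\mu\ge 0$, satisfying $((P^1_{T_u})'\mu)_j<\gamma^{-1}(\mu)_j$ for every $j=1,\ldots,N-1$. *)

theory Defs
  imports "HOL-Analysis.Lebesgue_Measure" "Jordan_Normal_Form.Matrix"
begin

text \<open>
  Indices start at 0: the cells are \<open>D 0, \<dots>, D (N - 1)\<close>, the last one \<open>D (N - 1)\<close> contains the
  attractor, and the cells outside of it are those with index below \<open>n = N - 1\<close>.  The control values
  are \<open>u 0, \<dots>, u (M - 1)\<close>, and a family \<open>\<theta>\<close> of vectors is only relevant at indices below \<open>M\<close>.
\<close>

no_notation Finite_Cartesian_Product.vec_nth (infixl \<open>$\<close> 90)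
hide_const (open) Finite_Cartesian_Product.vec Finite_Cartesian_Product.mat
  Finite_Cartesian_Product.row

definition cell_partition :: "'a::euclidean_space set \<Rightarrow> nat \<Rightarrow> (nat \<Rightarrow> 'a set) \<Rightarrow> bool" where
  "cell_partition X N D \<longleftrightarrow>
     (\<Union>i<N. D i) = X \<and> disjoint_family_on D {..<N} \<and>
     (\<forall>i<N. D i \<in> sets borel \<and> 0 < measure lborel (D i))"

definition transition_matrix ::
    "('a::euclidean_space \<Rightarrow> 'a) \<Rightarrow> (nat \<Rightarrow> 'a set) \<Rightarrow> nat \<Rightarrow> real mat" where
  "transition_matrix f D N =
     mat N N (\<lambda>(i, j). measure lborel (f -` D j \<inter> D i) / measure lborel (D i))"

definition sub_markov_matrix ::
    "('a::euclidean_space \<Rightarrow> 'a) \<Rightarrow> (nat \<Rightarrow> 'a set) \<Rightarrow> nat \<Rightarrow> real mat" where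
  "sub_markov_matrix f D N =
     mat (N - 1) (N - 1) (\<lambda>(i, j). transition_matrix f D N $$ (i, j))"

definition primal_feasible ::
    "nat \<Rightarrow> nat \<Rightarrow> real \<Rightarrow> (nat \<Rightarrow> real mat) \<Rightarrow> real vec \<Rightarrow> (nat \<Rightarrow> real vec) \<Rightarrow> bool" where
  "primal_feasible n M \<gamma> P m \<theta> \<longleftrightarrow>
     (\<forall>a<M. \<theta> a \<in> carrier_vec n \<and> 0\<^sub>v n \<le> \<theta> a) \<and>
     \<gamma> \<cdot>\<^sub>v finsum_vec TYPE(real) n (\<lambda>a. transpose_mat (P a) *\<^sub>v \<theta> a) {..<M}
       - finsum_vec TYPE(real) n \<theta> {..<M} = - m"

definition primal_cost :: "nat \<Rightarrow> (nat \<Rightarrow> real vec) \<Rightarrow> (nat \<Rightarrow> real vec) \<Rightarrow> real" where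
  "primal_cost M G \<theta> = (\<Sum>a<M. scalar_prod (G a) (\<theta> a))"

definition primal_optimal ::
    "nat \<Rightarrow> nat \<Rightarrow> real \<Rightarrow> (nat \<Rightarrow> real mat) \<Rightarrow> (nat \<Rightarrow> real vec) \<Rightarrow> real vec \<Rightarrow>
     (nat \<Rightarrow> real vec) \<Rightarrow> bool" where
  "primal_optimal n M \<gamma> P G m \<theta> \<longleftrightarrow>
     primal_feasible n M \<gamma> P m \<theta> \<and>
     (\<forall>\<theta>'. primal_feasible n M \<gamma> P m \<theta>' \<longrightarrow> primal_cost M G \<theta> \<le> primal_cost M G \<theta>')"

definition dual_feasible ::
    "nat \<Rightarrow> nat \<Rightarrow> real \<Rightarrow> (nat \<Rightarrow> real mat) \<Rightarrow> (nat \<Rightarrow> real vec) \<Rightarrow> real vec \<Rightarrow> bool" where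
  "dual_feasible n M \<gamma> P G V \<longleftrightarrow>
     V \<in> carrier_vec n \<and> (\<forall>a<M. V \<le> \<gamma> \<cdot>\<^sub>v (P a *\<^sub>v V) + G a)"

definition dual_optimal ::
    "nat \<Rightarrow> nat \<Rightarrow> real \<Rightarrow> (nat \<Rightarrow> real mat) \<Rightarrow> (nat \<Rightarrow> real vec) \<Rightarrow> real vec \<Rightarrow>
     real vec \<Rightarrow> bool" where
  "dual_optimal n M \<gamma> P G m V \<longleftrightarrow>
     dual_feasible n M \<gamma> P G V \<and>
     (\<forall>V'. dual_feasible n M \<gamma> P G V' \<longrightarrow> scalar_prod m V' \<le> scalar_prod m V)"

text \<open>The assignment \<open>c\<close> uses the control value \<open>u (c j)\<close> on the cell \<open>D j\<close>.\<close>

definition optimal_control ::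
    "nat \<Rightarrow> nat \<Rightarrow> real \<Rightarrow> (nat \<Rightarrow> real mat) \<Rightarrow> (nat \<Rightarrow> real vec) \<Rightarrow> real vec \<Rightarrow>
     (nat \<Rightarrow> nat) \<Rightarrow> bool" where
  "optimal_control n M \<gamma> P G m c \<longleftrightarrow>
     (\<forall>j<n. c j < M) \<and>
     (\<exists>\<theta>. primal_optimal n M \<gamma> P G m \<theta> \<and> (\<forall>j<n. \<forall>a<M. a \<noteq> c j \<longrightarrow> \<theta> a $ j = 0))"

definition closed_loop_matrix :: "nat \<Rightarrow> (nat \<Rightarrow> real mat) \<Rightarrow> (nat \<Rightarrow> nat) \<Rightarrow> real mat" where
  "closed_loop_matrix n P c = mat n n (\<lambda>(j, i). P (c j) $$ (j, i))"

definition lyapunov_measure :: "nat \<Rightarrow> real \<Rightarrow> real mat \<Rightarrow> real vec \<Rightarrow> bool" where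
  "lyapunov_measure n \<gamma> Pu \<mu> \<longleftrightarrow>
     \<mu> \<in> carrier_vec n \<and> 0\<^sub>v n \<le> \<mu> \<and>
     (\<forall>j<n. (transpose_mat Pu *\<^sub>v \<mu>) $ j < inverse \<gamma> * \<mu> $ j)"

end

(* Write an entrywise nonnegative matrix K as stable if K x < x for some x > 0. For stable K, the
   matrix I - K is invertible with nonnegative inverse, and so is its transpose. A feasible theta
   is a randomized policy whose total mass mu > 0 makes the transpose of gamma P_theta stable, so
   it has a value function V >= 0 with m'V equal to the cost of theta. A deterministic policy that
   is greedy for V is again stable and costs at most m'V, strictly less unless V satisfies the
   Bellman equation. Hence the minimum over the finitely many stable deterministic policies is
   optimal, the value function of any optimal theta is dual optimal, and every policy chosen in
   the support of an optimal theta attains equality in the Bellman equation, so that it is stable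
   with the same cost. *)

theory Submission
  imports Defs "Jordan_Normal_Form.Determinant"
begin

section \<open>Stable nonnegative matrices\<close>

text \<open>For a nonnegative matrix this says that the spectral radius is below 1. The witness form
  is chosen because total masses and value functions supply \<open>x\<close> directly. Matrices are
  functions here, so that transposing swaps arguments and a policy merely selects rows.\<close>

definition stable :: "nat \<Rightarrow> (nat \<Rightarrow> nat \<Rightarrow> real) \<Rightarrow> bool" where
  "stable n K \<longleftrightarrow> (\<forall>j<n. \<forall>i<n. 0 \<le> K j i) \<and>
     (\<exists>x. \<forall>j<n. 0 < x j \<and> (\<Sum>i<n. K j i * x i) < x j)"

lemma stable_nonneg: "stable n K \<Longrightarrow> j < n \<Longrightarrow> i < n \<Longrightarrow> 0 \<le> K j i"
  by (simp add: stable_def)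

text \<open>Compare \<open>y\<close> with \<open>t x\<close>, where \<open>t\<close> is the least ratio \<open>y j / x j\<close>: if \<open>t < 0\<close>, the
  inequality fails at the index where the ratio is attained.\<close>

lemma stable_monotone:
  assumes "stable n K" and y: "\<And>j. j < n \<Longrightarrow> (\<Sum>i<n. K j i * y i) \<le> y j" and "k < n"
  shows "0 \<le> y k"
proof (rule ccontr)
  assume neg: "\<not> 0 \<le> y k"
  obtain x where x: "\<And>j. j < n \<Longrightarrow> 0 < x j" "\<And>j. j < n \<Longrightarrow> (\<Sum>i<n. K j i * x i) < x j"
    using assms(1) by (auto simp: stable_def)
  have fin: "finite ((\<lambda>j. y j / x j) ` {..<n})" "(\<lambda>j. y j / x j) ` {..<n} \<noteq> {}"
    using \<open>k < n\<close> by auto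
  define t where "t = Min ((\<lambda>j. y j / x j) ` {..<n})"
  obtain j where j: "j < n" "t = y j / x j"
    using Min_in[OF fin] unfolding t_def by auto
  have le: "t \<le> y i / x i" if "i < n" for i
    using fin that unfolding t_def by (intro Min_le) auto
  have "y k / x k < 0"
    using neg x(1)[OF \<open>k < n\<close>] by (simp add: divide_less_0_iff)
  then have "t < 0"
    using le[OF \<open>k < n\<close>] by linarith
  have tx: "t * x i \<le> y i" if "i < n" for i
    using le[OF that] x(1)[OF that] by (simp add: pos_le_divide_eq)
  have "t * x j < t * (\<Sum>i<n. K j i * x i)"
    using x(2)[OF j(1)] \<open>t < 0\<close> by simp
  also have "\<dots> = (\<Sum>i<n. K j i * (t * x i))"
    by (simp add: sum_distrib_left mult.left_commute)
  also have "\<dots> \<le> (\<Sum>i<n. K j i * y i)"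
    using tx stable_nonneg[OF assms(1) j(1)] by (intro sum_mono mult_left_mono) auto
  also have "\<dots> \<le> y j"
    using y j(1) by blast
  also have "y j = t * x j"
    using j x(1)[of j] by simp
  finally show False by simp
qed

text \<open>Once solvability is known, this amounts to nonnegativity of the inverse of I -
  K.\<close>

lemma stable_solution_nonneg:
  assumes "stable n K"
    and y: "\<And>j. j < n \<Longrightarrow> y j = (\<Sum>i<n. K j i * y i) + g j"
    and g: "\<And>j. j < n \<Longrightarrow> 0 \<le> g j"
    and "k < n"
  shows "0 \<le> y k"
proof (rule stable_monotone[OF assms(1) _ \<open>k < n\<close>])
  fix j assume "j < n"
  show "(\<Sum>i<n. K j i * y i) \<le> y j"
    using y[OF \<open>j < n\<close>] g[OF \<open>j < n\<close>] by linarith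
qed

text \<open>Both differences of the two solutions solve the homogeneous equation, so both are
  nonnegative.\<close>

lemma stable_unique:
  assumes "stable n K"
    and y: "\<And>j. j < n \<Longrightarrow> y j = (\<Sum>i<n. K j i * y i) + g j"
    and z: "\<And>j. j < n \<Longrightarrow> z j = (\<Sum>i<n. K j i * z i) + g j"
    and "k < n"
  shows "y k = z k"
proof -
  have diff: "y j - z j = (\<Sum>i<n. K j i * (y i - z i)) + 0"
      "z j - y j = (\<Sum>i<n. K j i * (z i - y i)) + 0" if "j < n" for j
    using y[OF that] z[OF that] unfolding right_diff_distrib sum_subtractf by linarith+
  have "0 \<le> y k - z k"
    by (rule stable_solution_nonneg[OF assms(1) diff(1) _ \<open>k < n\<close>]) auto
  moreover have "0 \<le> z k - y k"
    by (rule stable_solution_nonneg[OF assms(1) diff(2) _ \<open>k < n\<close>]) auto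
  ultimately show ?thesis by simp
qed

lemma mult_mat_vec_sum:
  assumes "B \<in> carrier_mat n n" and "v \<in> carrier_vec n" and "j < n"
  shows "(B *\<^sub>v v) $ j = (\<Sum>i<n. B $$ (j, i) * v $ i)"
  using assms by (auto simp: scalar_prod_def lessThan_atLeast0 intro!: sum.cong)

lemma det_nonzero_solution:
  assumes B: "B \<in> carrier_mat n n" and "det B \<noteq> (0::real)"
  shows "\<exists>y. \<forall>j<n. (\<Sum>i<n. B $$ (j, i) * y i) = g j"
proof -
  obtain C where C: "C \<in> carrier_mat n n" "B * C = 1\<^sub>m n"
    using det_non_zero_imp_unit[OF B assms(2)]
    unfolding Units_def by (auto simp: ring_mat_def)
  define y where "y = C *\<^sub>v vec n g"
  have y: "y \<in> carrier_vec n" using C by (simp add: y_def)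
  have "B *\<^sub>v y = vec n g"
    using B C by (simp add: y_def assoc_mult_mat_vec[of _ n n _ n, symmetric])
  then show ?thesis
    using mult_mat_vec_sum[OF B y] by (metis index_vec)
qed

text \<open>Uniqueness makes I - K injective, hence its determinant is nonzero. Transposition
  preserves the determinant, so the transposed system is solvable too, before its stability is
  known.\<close>

lemma stable_solutions:
  assumes "stable n K"
  shows "\<exists>y. \<forall>j<n. y j = (\<Sum>i<n. K j i * y i) + g j"
    and "\<exists>z. \<forall>j<n. z j = (\<Sum>i<n. K i j * z i) + g j"
proof -
  define B where "B = mat n n (\<lambda>(j, i). (if j = i then 1 else 0) - K j i)"
  have B: "B \<in> carrier_mat n n" by (simp add: B_def)
  have Bsum: "(\<Sum>i<n. B $$ (j, i) * y i) = y j - (\<Sum>i<n. K j i * y i)" if "j < n" for j y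
    using that by (simp add: B_def left_diff_distrib sum_subtractf if_distrib[of "\<lambda>c. c * _"]
        cong: if_cong)
  have BTsum: "(\<Sum>i<n. B\<^sup>T $$ (j, i) * y i) = y j - (\<Sum>i<n. K i j * y i)" if "j < n" for j y
    using that by (simp add: B_def left_diff_distrib sum_subtractf if_distrib[of "\<lambda>c. c * _"]
        cong: if_cong)
  have det: "det B \<noteq> 0"
  proof
    assume "det B = 0"
    then obtain v where v: "v \<in> carrier_vec n" "v \<noteq> 0\<^sub>v n" "B *\<^sub>v v = 0\<^sub>v n"
      using det_0_iff_vec_prod_zero_field[OF B] by auto
    have "v $ j = (\<Sum>i<n. K j i * v $ i)" if "j < n" for j
      using mult_mat_vec_sum[OF B v(1) that] Bsum[OF that, of "\<lambda>i. v $ i"] v(3) that by simp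
    then have "v $ j = 0" if "j < n" for j
      using that by (intro stable_unique[OF assms, of "\<lambda>i. v $ i" "\<lambda>_. 0" "\<lambda>_. 0"]) auto
    then show False
      using v(1,2) by auto
  qed
  obtain y where "\<forall>j<n. (\<Sum>i<n. B $$ (j, i) * y i) = g j"
    using det_nonzero_solution[OF B det] by blast
  then have "\<forall>j<n. y j = (\<Sum>i<n. K j i * y i) + g j"
    by (simp add: Bsum diff_eq_eq add.commute)
  then show "\<exists>y. \<forall>j<n. y j = (\<Sum>i<n. K j i * y i) + g j"
    by blast
  have "B\<^sup>T \<in> carrier_mat n n" "det B\<^sup>T \<noteq> 0"
    using B det det_transpose[OF B] by auto
  from det_nonzero_solution[OF this]
  obtain z where "\<forall>j<n. (\<Sum>i<n. B\<^sup>T $$ (j, i) * z i) = g j" by blast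
  then have "\<forall>j<n. z j = (\<Sum>i<n. K i j * z i) + g j"
    by (simp add: BTsum diff_eq_eq add.commute)
  then show "\<exists>z. \<forall>j<n. z j = (\<Sum>i<n. K i j * z i) + g j"
    by blast
qed

text \<open>Both sides are the pairing of \<open>z\<close> with (I - K) y: the matrix moves to the
  other argument as its transpose.\<close>

lemma sum_pairing:
  fixes K :: "nat \<Rightarrow> nat \<Rightarrow> real"
  assumes "\<And>j. j < n \<Longrightarrow> y j = (\<Sum>i<n. K j i * y i) + g j"
    and "\<And>j. j < n \<Longrightarrow> z j = (\<Sum>i<n. K i j * z i) + h j"
  shows "(\<Sum>j<n. g j * z j) = (\<Sum>j<n. h j * y j)"
proof -
  have "(\<Sum>j<n. g j * z j) = (\<Sum>j<n. (y j - (\<Sum>i<n. K j i * y i)) * z j)"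
    using assms(1) by (intro sum.cong) (auto simp: algebra_simps)
  also have "\<dots> = (\<Sum>j<n. y j * z j) - (\<Sum>j<n. \<Sum>i<n. K j i * y i * z j)"
    by (simp add: left_diff_distrib sum_subtractf sum_distrib_right)
  also have "(\<Sum>j<n. \<Sum>i<n. K j i * y i * z j) = (\<Sum>j<n. \<Sum>i<n. K i j * y j * z i)"
    by (rule sum.swap)
  also have "(\<Sum>j<n. y j * z j) - \<dots> = (\<Sum>j<n. (z j - (\<Sum>i<n. K i j * z i)) * y j)"
    by (simp add: left_diff_distrib right_diff_distrib sum_subtractf sum_distrib_left mult_ac)
  also have "\<dots> = (\<Sum>j<n. h j * y j)"
    using assms(2) by (intro sum.cong) (auto simp: algebra_simps)
  finally show ?thesis .
qed

text \<open>The witness is the solution \<open>z\<close> of the transposed equation with right-hand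
  side 1. Its nonnegativity cannot be taken from monotonicity for the transpose, which would
  presuppose the claim.\<close>

lemma stable_transpose:
  assumes "stable n K"
  shows "stable n (\<lambda>j i. K i j)"
proof -
  obtain z where z: "\<And>j. j < n \<Longrightarrow> z j = (\<Sum>i<n. K i j * z i) + 1"
    using stable_solutions(2)[OF assms, of "\<lambda>_. 1"] by blast
  have nonneg: "0 \<le> z k" if "k < n" for k
  proof -
    \<comment> \<open>\<open>y\<close> is column \<open>k\<close> of the inverse of I - K; pairing
      it with \<open>z\<close> shows that \<open>z k\<close> is the sum of its entries.\<close>
    obtain y where y: "\<And>j. j < n \<Longrightarrow> y j = (\<Sum>i<n. K j i * y i) + (if j = k then 1 else 0)"
      using stable_solutions(1)[OF assms, of "\<lambda>j. if j = k then 1 else 0"] by blast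
    have "0 \<le> y j" if "j < n" for j
      by (rule stable_solution_nonneg[OF assms y _ that]) auto
    then have "0 \<le> (\<Sum>j<n. 1 * y j)"
      by (intro sum_nonneg) simp
    also have "\<dots> = (\<Sum>j<n. (if j = k then 1 else 0) * z j)"
      by (rule sum_pairing[OF y z, symmetric])
    also have "\<dots> = z k"
      using that by (simp add: if_distrib[of "\<lambda>c. c * _"] cong: if_cong)
    finally show ?thesis .
  qed
  have "0 < z j" if "j < n" for j
  proof -
    have "0 \<le> (\<Sum>i<n. K i j * z i)"
      using nonneg stable_nonneg[OF assms] that by (intro sum_nonneg) auto
    with z[OF that] show ?thesis by linarith
  qed
  moreover have "(\<Sum>i<n. K i j * z i) < z j" if "j < n" for j
    using z[OF that] by linarith
  ultimately show ?thesis
    using stable_nonneg[OF assms] unfolding stable_def by blast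
qed

section \<open>The linear program in coordinates\<close>

locale control_lp =
  fixes n M :: nat and \<gamma> :: real
    and P :: "nat \<Rightarrow> real mat" and G :: "nat \<Rightarrow> real vec" and m :: "real vec"
  assumes P_carrier: "a < M \<Longrightarrow> P a \<in> carrier_mat n n"
    and P_nonneg: "a < M \<Longrightarrow> j < n \<Longrightarrow> i < n \<Longrightarrow> 0 \<le> P a $$ (j, i)"
    and G_carrier: "a < M \<Longrightarrow> G a \<in> carrier_vec n"
    and G_pos: "a < M \<Longrightarrow> j < n \<Longrightarrow> 0 < G a $ j"
    and m_carrier: "m \<in> carrier_vec n"
    and m_pos: "j < n \<Longrightarrow> 0 < m $ j"
    and \<gamma>_pos: "0 < \<gamma>"
begin

text \<open>With \<open>\<gamma>\<close> absorbed into the kernel, stability of a policy is a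
  statement about \<open>K\<close> alone.\<close>

definition K :: "nat \<Rightarrow> nat \<Rightarrow> nat \<Rightarrow> real" where
  "K a j i = \<gamma> * P a $$ (j, i)"

text \<open>The right side of the dual constraint, read as a one-step operator of dynamic
  programming.\<close>

definition bellman :: "nat \<Rightarrow> (nat \<Rightarrow> real) \<Rightarrow> nat \<Rightarrow> real" where
  "bellman a V j = (\<Sum>i<n. K a j i * V i) + G a $ j"

text \<open>The choice is meaningful when the closed loop of \<open>c\<close> is stable: then the
  flow equation has a solution, unique below \<open>n\<close>.\<close>

definition occupation :: "(nat \<Rightarrow> nat) \<Rightarrow> nat \<Rightarrow> real" where
  "occupation c = (SOME \<mu>. \<forall>j<n. \<mu> j = (\<Sum>i<n. K (c i) i j * \<mu> i) + m $ j)"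

definition policy_solution :: "(nat \<Rightarrow> nat) \<Rightarrow> nat \<Rightarrow> real vec" where
  "policy_solution c a = vec n (\<lambda>j. if a = c j then occupation c j else 0)"

lemma K_nonneg: "a < M \<Longrightarrow> j < n \<Longrightarrow> i < n \<Longrightarrow> 0 \<le> K a j i"
  using P_nonneg \<gamma>_pos by (simp add: K_def)

text \<open>In entries the constraint is a flow balance: the mass on a cell is the amplified inflow
  plus the supply \<open>m\<close>. If some vector has the wrong dimension, both sides are
  false.\<close>

lemma primal_feasible_iff:
  "primal_feasible n M \<gamma> P m \<theta> \<longleftrightarrow>
     (\<forall>a<M. \<theta> a \<in> carrier_vec n \<and> (\<forall>j<n. 0 \<le> \<theta> a $ j)) \<and>
     (\<forall>j<n. (\<Sum>a<M. \<theta> a $ j) = (\<Sum>a<M. \<Sum>i<n. K a i j * \<theta> a $ i) + m $ j)"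
proof (cases "\<forall>a<M. \<theta> a \<in> carrier_vec n")
  case False
  then show ?thesis by (auto simp: primal_feasible_def)
next
  case True
  have car: "(\<lambda>a. transpose_mat (P a) *\<^sub>v \<theta> a) \<in> {..<M} \<rightarrow> carrier_vec n" "\<theta> \<in> {..<M} \<rightarrow> carrier_vec n"
    using True P_carrier by (auto intro!: mult_mat_vec_carrier)
  define L where "L = finsum_vec TYPE(real) n (\<lambda>a. transpose_mat (P a) *\<^sub>v \<theta> a) {..<M}"
  define R where "R = finsum_vec TYPE(real) n \<theta> {..<M}"
  have dims: "L \<in> carrier_vec n" "R \<in> carrier_vec n"
    unfolding L_def R_def using car by (auto intro!: finsum_vec_closed)
  have L: "\<gamma> * L $ j = (\<Sum>a<M. \<Sum>i<n. K a i j * \<theta> a $ i)" if "j < n" for j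
  proof -
    have "L $ j = (\<Sum>a<M. (transpose_mat (P a) *\<^sub>v \<theta> a) $ j)"
      unfolding L_def using car that by (intro index_finsum_vec) auto
    also have "\<dots> = (\<Sum>a<M. \<Sum>i<n. P a $$ (i, j) * \<theta> a $ i)"
    proof (intro sum.cong refl)
      fix a assume "a \<in> {..<M}"
      then have "P a \<in> carrier_mat n n" "\<theta> a \<in> carrier_vec n" using P_carrier True by auto
      then show "(transpose_mat (P a) *\<^sub>v \<theta> a) $ j = (\<Sum>i<n. P a $$ (i, j) * \<theta> a $ i)"
        using that by (subst mult_mat_vec_sum[of _ n]) auto
    qed
    finally show ?thesis by (simp add: K_def sum_distrib_left mult.assoc)
  qed
  have R: "R $ j = (\<Sum>a<M. \<theta> a $ j)" if "j < n" for j
    unfolding R_def using car that by (intro index_finsum_vec) auto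
  have "\<gamma> \<cdot>\<^sub>v L - R = - m \<longleftrightarrow> (\<forall>j<n. \<gamma> * L $ j - R $ j = - m $ j)"
    using dims m_carrier by (auto simp: vec_eq_iff)
  also have "\<dots> \<longleftrightarrow> (\<forall>j<n. (\<Sum>a<M. \<theta> a $ j) = (\<Sum>a<M. \<Sum>i<n. K a i j * \<theta> a $ i) + m $ j)"
    by (auto simp: L R algebra_simps)
  finally have eq: "\<gamma> \<cdot>\<^sub>v L - R = - m \<longleftrightarrow>
      (\<forall>j<n. (\<Sum>a<M. \<theta> a $ j) = (\<Sum>a<M. \<Sum>i<n. K a i j * \<theta> a $ i) + m $ j)" .
  have "0\<^sub>v n \<le> v \<longleftrightarrow> (\<forall>j<n. 0 \<le> v $ j)" if "v \<in> carrier_vec n" for v :: "real vec"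
    using that by (auto simp: less_eq_vec_def)
  then have "(\<forall>a<M. \<theta> a \<in> carrier_vec n \<and> 0\<^sub>v n \<le> \<theta> a) \<longleftrightarrow>
      (\<forall>a<M. \<theta> a \<in> carrier_vec n \<and> (\<forall>j<n. 0 \<le> \<theta> a $ j))"
    by (simp cong: conj_cong)
  then show ?thesis
    unfolding primal_feasible_def L_def[symmetric] R_def[symmetric] eq by (simp only:)
qed

lemma dual_feasible_iff:
  "dual_feasible n M \<gamma> P G V \<longleftrightarrow>
     V \<in> carrier_vec n \<and> (\<forall>a<M. \<forall>j<n. V $ j \<le> bellman a (\<lambda>i. V $ i) j)"
proof (cases "V \<in> carrier_vec n")
  case True
  have "V \<le> \<gamma> \<cdot>\<^sub>v (P a *\<^sub>v V) + G a \<longleftrightarrow> (\<forall>j<n. V $ j \<le> bellman a (\<lambda>i. V $ i) j)"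
    if "a < M" for a
  proof -
    have "(\<gamma> \<cdot>\<^sub>v (P a *\<^sub>v V) + G a) $ j = bellman a (\<lambda>i. V $ i) j" if "j < n" for j
      using \<open>a < M\<close> that True P_carrier[of a] G_carrier[of a]
        mult_mat_vec_sum[OF P_carrier[of a] True that]
      by (simp add: bellman_def K_def sum_distrib_left mult.assoc del: index_mult_mat_vec)
    then show ?thesis
      using True G_carrier[OF that] P_carrier[OF that] by (auto simp: less_eq_vec_def)
  qed
  then show ?thesis using True by (auto simp: dual_feasible_def)
qed (auto simp: dual_feasible_def)

section \<open>Cost identities and weak duality\<close>

lemma primal_cost_eq:
  "primal_feasible n M \<gamma> P m \<theta> \<Longrightarrow> primal_cost M G \<theta> = (\<Sum>j<n. \<Sum>a<M. \<theta> a $ j * G a $ j)"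
  unfolding primal_cost_def primal_feasible_iff
  by (subst sum.swap) (auto simp: scalar_prod_def lessThan_atLeast0 mult.commute intro!: sum.cong)

text \<open>Here \<open>V\<close> is arbitrary. Replacing \<open>m\<close> by the flow balance and
  moving the kernel over to \<open>V\<close> turns the gap into reduced costs weighted by \<theta>.
  Weak duality and all later cost comparisons rest on this identity.\<close>

lemma primal_pairing:
  assumes "primal_feasible n M \<gamma> P m \<theta>"
  shows "primal_cost M G \<theta> - (\<Sum>j<n. m $ j * V j) = (\<Sum>j<n. \<Sum>a<M. \<theta> a $ j * (bellman a V j - V j))"
proof -
  have "(\<Sum>j<n. m $ j * V j) =
      (\<Sum>j<n. ((\<Sum>a<M. \<theta> a $ j) - (\<Sum>a<M. \<Sum>i<n. K a i j * \<theta> a $ i)) * V j)"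
    using assms by (intro sum.cong) (auto simp: primal_feasible_iff)
  also have "\<dots> = (\<Sum>j<n. \<Sum>a<M. \<theta> a $ j * V j) - (\<Sum>j<n. \<Sum>a<M. \<Sum>i<n. K a i j * \<theta> a $ i * V j)"
    by (simp add: left_diff_distrib sum_subtractf sum_distrib_right)
  \<comment> \<open>Three exchanges of sums trade the roles of source and target cell, so that
    inflow becomes outflow.\<close>
  also have "(\<Sum>j<n. \<Sum>a<M. \<Sum>i<n. K a i j * \<theta> a $ i * V j) =
      (\<Sum>a<M. \<Sum>j<n. \<Sum>i<n. K a i j * \<theta> a $ i * V j)"
    by (rule sum.swap)
  also have "\<dots> = (\<Sum>a<M. \<Sum>i<n. \<Sum>j<n. K a i j * \<theta> a $ i * V j)"
    by (intro sum.cong refl sum.swap)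
  also have "\<dots> = (\<Sum>i<n. \<Sum>a<M. \<Sum>j<n. K a i j * \<theta> a $ i * V j)"
    by (rule sum.swap)
  also have "\<dots> = (\<Sum>j<n. \<Sum>a<M. \<theta> a $ j * (\<Sum>i<n. K a j i * V i))"
    by (simp add: sum_distrib_left mult_ac)
  finally show ?thesis
    by (simp add: primal_cost_eq[OF assms] bellman_def distrib_left right_diff_distrib
        sum.distrib sum_subtractf)
qed

lemma weak_duality:
  assumes "primal_feasible n M \<gamma> P m \<theta>" and "dual_feasible n M \<gamma> P G V"
  shows "(\<Sum>j<n. m $ j * V $ j) \<le> primal_cost M G \<theta>"
proof -
  have "0 \<le> (\<Sum>j<n. \<Sum>a<M. \<theta> a $ j * (bellman a (\<lambda>i. V $ i) j - V $ j))"
    using assms by (intro sum_nonneg mult_nonneg_nonneg)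
      (auto simp: primal_feasible_iff dual_feasible_iff)
  then show ?thesis
    using primal_pairing[OF assms(1), of "\<lambda>i. V $ i"] by linarith
qed

section \<open>Randomized policies and their value functions\<close>

text \<open>Inflow is nonnegative and the supply is positive. This permits division by the total
  mass, and it makes the support of \<theta> nonempty on every cell.\<close>

lemma total_mass_pos:
  assumes "primal_feasible n M \<gamma> P m \<theta>" and "j < n"
  shows "0 < (\<Sum>a<M. \<theta> a $ j)"
proof -
  have "0 \<le> (\<Sum>a<M. \<Sum>i<n. K a i j * \<theta> a $ i)"
    using assms K_nonneg by (intro sum_nonneg mult_nonneg_nonneg) (auto simp: primal_feasible_iff)
  then show ?thesis
    using assms m_pos[of j] by (auto simp: primal_feasible_iff)
qed

text \<open>A feasible \<open>\<theta>\<close> is a randomized policy choosing \<open>a\<close> on the cell \<open>j\<close> with probability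
  \<open>\<theta> a $ j / (\<Sum>a<M. \<theta> a $ j)\<close>; \<open>V\<close> is its value function.\<close>

lemma value_function:
  assumes feas: "primal_feasible n M \<gamma> P m \<theta>"
  obtains V where "\<And>j. j < n \<Longrightarrow> 0 \<le> V j"
    and "\<And>j. j < n \<Longrightarrow> (\<Sum>a<M. \<theta> a $ j * (bellman a V j - V j)) = 0"
    and "primal_cost M G \<theta> = (\<Sum>j<n. m $ j * V j)"
proof -
  define \<mu> where "\<mu> j = (\<Sum>a<M. \<theta> a $ j)" for j
  \<comment> \<open>\<open>Q\<close> and \<open>g\<close> are the kernel and the cost averaged over
    the randomized choice of control.\<close>
  define Q where "Q j i = (\<Sum>a<M. \<theta> a $ j * K a j i) / \<mu> j" for j i
  define g where "g j = (\<Sum>a<M. \<theta> a $ j * G a $ j) / \<mu> j" for j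
  have \<mu>_pos: "0 < \<mu> j" if "j < n" for j
    using total_mass_pos[OF feas that] by (simp add: \<mu>_def)
  have \<theta>_nonneg: "0 \<le> \<theta> a $ j" if "a < M" "j < n" for a j
    using feas that by (simp add: primal_feasible_iff)
  have Q_nonneg: "0 \<le> Q j i" if "j < n" "i < n" for j i
    unfolding Q_def using that \<theta>_nonneg K_nonneg \<mu>_pos[of j]
    by (intro divide_nonneg_pos sum_nonneg mult_nonneg_nonneg) auto
  have g_nonneg: "0 \<le> g j" if "j < n" for j
    unfolding g_def using that \<theta>_nonneg G_pos \<mu>_pos[of j]
    by (intro divide_nonneg_pos sum_nonneg mult_nonneg_nonneg) (auto intro: less_imp_le)
  have flow: "\<mu> j = (\<Sum>i<n. Q i j * \<mu> i) + m $ j" if "j < n" for j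
  proof -
    have "(\<Sum>i<n. Q i j * \<mu> i) = (\<Sum>i<n. \<Sum>a<M. K a i j * \<theta> a $ i)"
      using \<mu>_pos by (intro sum.cong refl) (force simp: Q_def mult.commute)
    also have "\<dots> = (\<Sum>a<M. \<Sum>i<n. K a i j * \<theta> a $ i)"
      by (rule sum.swap)
    finally show ?thesis
      using feas that by (simp add: primal_feasible_iff \<mu>_def)
  qed
  have "(\<Sum>i<n. Q i j * \<mu> i) < \<mu> j" if "j < n" for j
    using flow[OF that] m_pos[OF that] by linarith
  \<comment> \<open>The total mass \<open>\<mu>\<close> strictly exceeds its own inflow, so it
    witnesses stability of the transpose; transposing back gives stability of
    \<open>Q\<close>.\<close>
  then have "stable n (\<lambda>j i. Q i j)"
    using Q_nonneg \<mu>_pos unfolding stable_def by blast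
  then have Q: "stable n Q"
    using stable_transpose[of n "\<lambda>j i. Q i j"] by simp
  then obtain V where V: "\<And>j. j < n \<Longrightarrow> V j = (\<Sum>i<n. Q j i * V i) + g j"
    using stable_solutions(1)[OF Q, of g] by blast
  have "0 \<le> V j" if "j < n" for j
    by (rule stable_solution_nonneg[OF Q V g_nonneg that])
  moreover have bell: "(\<Sum>a<M. \<theta> a $ j * (bellman a V j - V j)) = 0" if "j < n" for j
  proof -
    have "(\<Sum>a<M. \<theta> a $ j * bellman a V j) =
        (\<Sum>i<n. (\<Sum>a<M. \<theta> a $ j * K a j i) * V i) + (\<Sum>a<M. \<theta> a $ j * G a $ j)"
      unfolding bellman_def distrib_left sum.distrib sum_distrib_left sum_distrib_right mult.assoc
      by (subst sum.swap) simp
    \<comment> \<open>The factor \<open>\<mu> j\<close> restores the denominators of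
      \<open>Q\<close> and \<open>g\<close>, so the equation for \<open>V\<close> applies.\<close>
    also have "\<dots> = \<mu> j * ((\<Sum>i<n. Q j i * V i) + g j)"
      using \<mu>_pos[OF that] by (simp add: Q_def g_def distrib_left sum_distrib_left[of "\<mu> j" _ "{..<n}"])
    also have "\<dots> = (\<Sum>a<M. \<theta> a $ j * V j)"
      using V[OF that] by (simp add: \<mu>_def sum_distrib_right)
    finally show ?thesis
      by (simp add: right_diff_distrib sum_subtractf)
  qed
  moreover have "primal_cost M G \<theta> = (\<Sum>j<n. m $ j * V j)"
    using primal_pairing[OF feas, of V] bell by simp
  ultimately show thesis by (rule that)
qed

section \<open>Deterministic policies\<close>

lemma occupation_eq:
  assumes "stable n (\<lambda>j. K (c j) j)" and "j < n"
  shows "occupation c j = (\<Sum>i<n. K (c i) i j * occupation c i) + m $ j"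
  using someI_ex[OF stable_solutions(2)[OF assms(1), of "\<lambda>j. m $ j"]] assms(2)
  unfolding occupation_def by blast

text \<open>The transposed kernel is stable, which gives nonnegativity; the positive supply then
  makes it strict.\<close>

lemma occupation_pos:
  assumes "stable n (\<lambda>j. K (c j) j)" and "j < n"
  shows "0 < occupation c j"
proof -
  note T = stable_transpose[OF assms(1)]
  have nonneg: "0 \<le> occupation c i" if "i < n" for i
    using m_pos by (intro stable_solution_nonneg[OF T occupation_eq[OF assms(1)] _ that])
      (auto intro: less_imp_le)
  then have "0 \<le> (\<Sum>i<n. K (c i) i j * occupation c i)"
    using stable_nonneg[OF assms(1)] assms(2) by (intro sum_nonneg) auto
  then show ?thesis
    using occupation_eq[OF assms] m_pos[OF assms(2)] by linarith
qed

lemma sum_policy_solution: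
  assumes "c j < M" and "j < n"
  shows "(\<Sum>a<M. policy_solution c a $ j * f a) = occupation c j * f (c j)"
  using assms by (simp add: policy_solution_def if_distrib[of "\<lambda>x. x * _"] cong: if_cong)

text \<open>With all mass of a cell on one control, the flow balance collapses to the equation of
  \<open>occupation c\<close>.\<close>

lemma policy_solution_feasible:
  assumes c: "\<And>j. j < n \<Longrightarrow> c j < M" and st: "stable n (\<lambda>j. K (c j) j)"
  shows "primal_feasible n M \<gamma> P m (policy_solution c)"
proof -
  have "(\<Sum>a<M. policy_solution c a $ j) =
      (\<Sum>a<M. \<Sum>i<n. K a i j * policy_solution c a $ i) + m $ j" if "j < n" for j
  proof -
    have "(\<Sum>a<M. \<Sum>i<n. K a i j * policy_solution c a $ i) =
        (\<Sum>i<n. \<Sum>a<M. policy_solution c a $ i * K a i j)"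
      by (subst sum.swap) (simp add: mult.commute)
    also have "\<dots> = (\<Sum>i<n. occupation c i * K (c i) i j)"
      using c by (intro sum.cong refl) (simp add: sum_policy_solution)
    finally show ?thesis
      using occupation_eq[OF st that] sum_policy_solution[of c j "\<lambda>_. 1"] c[OF that] that
      by (simp add: mult.commute)
  qed
  then show ?thesis
    using less_imp_le[OF occupation_pos[OF st]]
    by (auto simp: primal_feasible_iff policy_solution_def)
qed

text \<open>The positive cost makes the inequality strict, and nonnegativity of the kernel then
  forces \<open>V\<close> to be positive. So \<open>V\<close> itself is the witness of
  stability.\<close>

lemma policy_stable:
  assumes c: "\<And>j. j < n \<Longrightarrow> c j < M" and V: "\<And>j. j < n \<Longrightarrow> 0 \<le> V j"
    and le: "\<And>j. j < n \<Longrightarrow> bellman (c j) V j \<le> V j"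
  shows "stable n (\<lambda>j. K (c j) j)"
proof -
  have "(\<Sum>i<n. K (c j) j i * V i) < V j" if "j < n" for j
    using le[OF that] G_pos[OF c[OF that] that] by (simp add: bellman_def)
  moreover have "0 \<le> (\<Sum>i<n. K (c j) j i * V i)" if "j < n" for j
    using that K_nonneg c V by (intro sum_nonneg mult_nonneg_nonneg) auto
  ultimately show ?thesis
    using K_nonneg c unfolding stable_def by (meson le_less_trans)
qed

text \<open>A performance difference formula: relative to a reference \<open>V\<close>, the cost
  changes by the Bellman defects, weighted by the occupation.\<close>

lemma policy_cost:
  assumes c: "\<And>j. j < n \<Longrightarrow> c j < M" and st: "stable n (\<lambda>j. K (c j) j)"
  shows "primal_cost M G (policy_solution c) =
    (\<Sum>j<n. m $ j * V j) + (\<Sum>j<n. occupation c j * (bellman (c j) V j - V j))"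
proof -
  have "(\<Sum>j<n. \<Sum>a<M. policy_solution c a $ j * (bellman a V j - V j)) =
      (\<Sum>j<n. occupation c j * (bellman (c j) V j - V j))"
    using c by (intro sum.cong refl) (auto simp: sum_policy_solution)
  then show ?thesis
    using primal_pairing[OF policy_solution_feasible[OF assms], of V] by simp
qed

text \<open>The defects \<open>bellman a V j - V j\<close> have \<theta>-weighted sum zero on each
  cell, so the least of them is at most zero.\<close>

lemma greedy_policy:
  assumes feas: "primal_feasible n M \<gamma> P m \<theta>"
    and V: "\<And>j. j < n \<Longrightarrow> (\<Sum>a<M. \<theta> a $ j * (bellman a V j - V j)) = 0"
  obtains c where "c \<in> {..<n} \<rightarrow>\<^sub>E {..<M}"
    and "\<And>j a. j < n \<Longrightarrow> a < M \<Longrightarrow> bellman (c j) V j \<le> bellman a V j"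
    and "\<And>j. j < n \<Longrightarrow> bellman (c j) V j \<le> V j"
proof -
  have ex: "\<exists>b<M. \<forall>a<M. bellman b V j \<le> bellman a V j" if "j < n" for j
  proof -
    \<comment> \<open>Positive mass on a cell requires at least one control.\<close>
    have "M \<noteq> 0"
      using total_mass_pos[OF feas that] by (cases M) auto
    then have "finite ((\<lambda>a. bellman a V j) ` {..<M})" "(\<lambda>a. bellman a V j) ` {..<M} \<noteq> {}"
      by auto
    from Min_in[OF this] obtain b where "b < M" "Min ((\<lambda>a. bellman a V j) ` {..<M}) = bellman b V j"
      by auto
    then show ?thesis
      by (metis Min_le \<open>finite ((\<lambda>a. bellman a V j) ` {..<M})\<close> image_eqI lessThan_iff)
  qed
  \<comment> \<open>Restriction makes the policy extensional, so that it belongs to a finite set of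
    policies.\<close>
  define c where "c = restrict (\<lambda>j. SOME b. b < M \<and> (\<forall>a<M. bellman b V j \<le> bellman a V j)) {..<n}"
  have c: "c j < M \<and> (\<forall>a<M. bellman (c j) V j \<le> bellman a V j)" if "j < n" for j
    using someI_ex[OF ex[OF that]] that by (simp add: c_def)
  have "bellman (c j) V j \<le> V j" if "j < n" for j
  proof -
    have "(\<Sum>a<M. \<theta> a $ j) * (bellman (c j) V j - V j) =
        (\<Sum>a<M. \<theta> a $ j * (bellman (c j) V j - V j))"
      by (simp add: sum_distrib_right)
    also have "\<dots> \<le> (\<Sum>a<M. \<theta> a $ j * (bellman a V j - V j))"
      using c[OF that] feas that by (intro sum_mono mult_left_mono) (auto simp: primal_feasible_iff)
    finally have "(\<Sum>a<M. \<theta> a $ j) * (bellman (c j) V j - V j) \<le> 0"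
      using V[OF that] by simp
    then show ?thesis
      using total_mass_pos[OF feas that] by (simp add: mult_le_0_iff)
  qed
  moreover have "c \<in> {..<n} \<rightarrow>\<^sub>E {..<M}"
    using c by (auto simp: c_def)
  ultimately show thesis
    using c by (intro that[of c]) auto
qed

section \<open>Optimal solutions and complementary slackness\<close>

text \<open>Greedy improvement dominates each feasible point by a point of the finite family
  \<open>S\<close>, so a minimizer over \<open>S\<close> is a global one.\<close>

lemma primal_optimal_exists:
  assumes "primal_feasible n M \<gamma> P m \<theta>\<^sub>0"
  shows "\<exists>\<theta>. primal_optimal n M \<gamma> P G m \<theta>"
proof -
  define S where "S = {c \<in> {..<n} \<rightarrow>\<^sub>E {..<M}. primal_feasible n M \<gamma> P m (policy_solution c)}"
  have "finite S"
    by (auto simp: S_def intro!: finite_subset[OF _ finite_PiE[of "{..<n}" "\<lambda>_. {..<M}"]])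
  have better: "\<exists>c\<in>S. primal_cost M G (policy_solution c) \<le> primal_cost M G \<theta>"
    if feas: "primal_feasible n M \<gamma> P m \<theta>" for \<theta>
  proof -
    obtain V where V: "\<And>j. j < n \<Longrightarrow> 0 \<le> V j"
      "\<And>j. j < n \<Longrightarrow> (\<Sum>a<M. \<theta> a $ j * (bellman a V j - V j)) = 0"
      "primal_cost M G \<theta> = (\<Sum>j<n. m $ j * V j)"
      using value_function[OF feas] by blast
    obtain c where c: "c \<in> {..<n} \<rightarrow>\<^sub>E {..<M}"
      "\<And>j a. j < n \<Longrightarrow> a < M \<Longrightarrow> bellman (c j) V j \<le> bellman a V j"
      "\<And>j. j < n \<Longrightarrow> bellman (c j) V j \<le> V j"
      using greedy_policy[OF feas V(2)] by blast
    have cM: "\<And>j. j < n \<Longrightarrow> c j < M" using c(1) by auto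
    have st: "stable n (\<lambda>j. K (c j) j)"
      by (rule policy_stable[OF cM V(1) c(3)])
    have "(\<Sum>j<n. occupation c j * (bellman (c j) V j - V j)) \<le> 0"
      using c(3) occupation_pos[OF st] by (intro sum_nonpos mult_nonneg_nonpos) (auto intro: less_imp_le)
    then have "primal_cost M G (policy_solution c) \<le> primal_cost M G \<theta>"
      using policy_cost[OF cM st, of V] V(3) by simp
    then show ?thesis
      using policy_solution_feasible[OF cM st] c(1) by (auto simp: S_def)
  qed
  then have "S \<noteq> {}"
    using assms by blast
  with \<open>finite S\<close> obtain c where c: "c \<in> S"
    "\<And>c'. c' \<in> S \<Longrightarrow> primal_cost M G (policy_solution c) \<le> primal_cost M G (policy_solution c')"
    by (meson arg_min_if_finite(1) arg_min_least)
  have "primal_cost M G (policy_solution c) \<le> primal_cost M G \<theta>"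
    if "primal_feasible n M \<gamma> P m \<theta>" for \<theta>
    using better[OF that] c(2) order_trans by blast
  then have "primal_optimal n M \<gamma> P G m (policy_solution c)"
    using c(1) by (simp add: primal_optimal_def S_def)
  then show ?thesis by blast
qed

text \<open>If \<open>V j\<close> exceeded the least \<open>bellman a V j\<close> for some \<open>j\<close>, the greedy policy would cost less
  than \<open>\<theta>\<close>.\<close>

lemma value_function_optimal:
  assumes opt: "primal_optimal n M \<gamma> P G m \<theta>"
  obtains V where "\<And>j. j < n \<Longrightarrow> 0 \<le> V j"
    and "\<And>j a. j < n \<Longrightarrow> a < M \<Longrightarrow> V j \<le> bellman a V j"
    and "\<And>j a. j < n \<Longrightarrow> a < M \<Longrightarrow> 0 < \<theta> a $ j \<Longrightarrow> bellman a V j = V j"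
    and "primal_cost M G \<theta> = (\<Sum>j<n. m $ j * V j)"
proof -
  have feas: "primal_feasible n M \<gamma> P m \<theta>"
    and le: "\<And>\<theta>'. primal_feasible n M \<gamma> P m \<theta>' \<Longrightarrow> primal_cost M G \<theta> \<le> primal_cost M G \<theta>'"
    using opt by (auto simp: primal_optimal_def)
  obtain V where V: "\<And>j. j < n \<Longrightarrow> 0 \<le> V j"
    "\<And>j. j < n \<Longrightarrow> (\<Sum>a<M. \<theta> a $ j * (bellman a V j - V j)) = 0"
    "primal_cost M G \<theta> = (\<Sum>j<n. m $ j * V j)"
    using value_function[OF feas] by blast
  obtain c where c: "c \<in> {..<n} \<rightarrow>\<^sub>E {..<M}"
    "\<And>j a. j < n \<Longrightarrow> a < M \<Longrightarrow> bellman (c j) V j \<le> bellman a V j"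
    "\<And>j. j < n \<Longrightarrow> bellman (c j) V j \<le> V j"
    using greedy_policy[OF feas V(2)] by blast
  have cM: "\<And>j. j < n \<Longrightarrow> c j < M" using c(1) by auto
  have st: "stable n (\<lambda>j. K (c j) j)"
    by (rule policy_stable[OF cM V(1) c(3)])
  \<comment> \<open>Optimality of \<theta> forbids a cheaper greedy policy, and the costs differ by
    exactly this sum.\<close>
  have "0 \<le> (\<Sum>j<n. occupation c j * (bellman (c j) V j - V j))"
    using le[OF policy_solution_feasible[OF cM st]] policy_cost[OF cM st, of V] V(3) by simp
  then have "(\<Sum>j<n. occupation c j * (V j - bellman (c j) V j)) \<le> 0"
    by (simp add: right_diff_distrib sum_subtractf)
  moreover have terms: "0 \<le> occupation c j * (V j - bellman (c j) V j)" if "j < n" for j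
    using c(3)[OF that] occupation_pos[OF st that] by simp
  ultimately have "(\<Sum>j<n. occupation c j * (V j - bellman (c j) V j)) = 0"
    by (intro antisym sum_nonneg) auto
  then have "occupation c j * (V j - bellman (c j) V j) = 0" if "j < n" for j
    using terms that by (subst (asm) sum_nonneg_eq_0_iff) auto
  then have greedy_eq: "bellman (c j) V j = V j" if "j < n" for j
    using occupation_pos[OF st that] that by fastforce
  then have Vle: "V j \<le> bellman a V j" if "j < n" "a < M" for j a
    using c(2) that by metis
  have "bellman a V j = V j" if "j < n" "a < M" "0 < \<theta> a $ j" for j a
  proof -
    \<comment> \<open>Now no defect is negative, so the vanishing weighted sum has only zero terms:
      complementary slackness.\<close>
    have "\<forall>a\<in>{..<M}. \<theta> a $ j * (bellman a V j - V j) = 0"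
      using V(2)[OF that(1)] Vle feas that(1)
      by (subst (asm) sum_nonneg_eq_0_iff) (auto simp: primal_feasible_iff)
    then show ?thesis using that by force
  qed
  with V Vle show thesis by (intro that) auto
qed

text \<open>The value function of an optimal \<theta> is dual feasible and attains the primal
  optimum, which bounds every dual value by weak duality.\<close>

lemma dual_optimal_exists:
  assumes "primal_feasible n M \<gamma> P m \<theta>\<^sub>0"
  shows "\<exists>V. dual_optimal n M \<gamma> P G m V"
proof -
  obtain \<theta> where opt: "primal_optimal n M \<gamma> P G m \<theta>"
    using primal_optimal_exists[OF assms] by blast
  obtain V where V: "\<And>j. j < n \<Longrightarrow> 0 \<le> V j"
    "\<And>j a. j < n \<Longrightarrow> a < M \<Longrightarrow> V j \<le> bellman a V j"
    "\<And>j a. j < n \<Longrightarrow> a < M \<Longrightarrow> 0 < \<theta> a $ j \<Longrightarrow> bellman a V j = V j"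
    "primal_cost M G \<theta> = (\<Sum>j<n. m $ j * V j)"
    using value_function_optimal[OF opt] by blast
  have sp: "scalar_prod m W = (\<Sum>j<n. m $ j * W $ j)" if "W \<in> carrier_vec n" for W
    using that by (simp add: scalar_prod_def lessThan_atLeast0)
  have bell: "bellman a (\<lambda>i. vec n V $ i) j = bellman a V j" for a j
    by (simp add: bellman_def)
  have "dual_feasible n M \<gamma> P G (vec n V)"
    using V(2) by (simp add: dual_feasible_iff bell)
  moreover have "scalar_prod m W \<le> scalar_prod m (vec n V)" if "dual_feasible n M \<gamma> P G W" for W
    using weak_duality[OF _ that, of \<theta>] opt V(4) that
    by (simp add: primal_optimal_def dual_feasible_iff sp)
  ultimately show ?thesis
    unfolding dual_optimal_def by blast
qed

text \<open>Any selection from the support will do. Complementary slackness gives equality in the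
  Bellman equation, which yields stability and makes the cost difference vanish.\<close>

lemma support_policy:
  assumes opt: "primal_optimal n M \<gamma> P G m \<theta>"
    and c: "\<And>j. j < n \<Longrightarrow> c j < M \<and> 0 < \<theta> (c j) $ j"
  shows "stable n (\<lambda>j. K (c j) j)" and "optimal_control n M \<gamma> P G m c"
proof -
  obtain V where V: "\<And>j. j < n \<Longrightarrow> 0 \<le> V j"
    "\<And>j a. j < n \<Longrightarrow> a < M \<Longrightarrow> V j \<le> bellman a V j"
    "\<And>j a. j < n \<Longrightarrow> a < M \<Longrightarrow> 0 < \<theta> a $ j \<Longrightarrow> bellman a V j = V j"
    "primal_cost M G \<theta> = (\<Sum>j<n. m $ j * V j)"
    using value_function_optimal[OF opt] by blast
  have cM: "\<And>j. j < n \<Longrightarrow> c j < M" using c by blast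
  have eq: "\<And>j. j < n \<Longrightarrow> bellman (c j) V j = V j" using V(3) c by blast
  show st: "stable n (\<lambda>j. K (c j) j)"
    by (rule policy_stable[of c V]) (use cM V(1) eq in auto)
  have "primal_cost M G (policy_solution c) = primal_cost M G \<theta>"
    using policy_cost[OF cM st, of V] V(4) eq by simp
  then have "primal_optimal n M \<gamma> P G m (policy_solution c)"
    using opt policy_solution_feasible[OF cM st] by (simp add: primal_optimal_def)
  then show "optimal_control n M \<gamma> P G m c"
    unfolding optimal_control_def using cM
    by (auto simp: policy_solution_def intro!: exI[of _ "policy_solution c"])
qed

section \<open>The closed loop and its Lyapunov measure\<close>

lemma closed_loop_index:
  assumes "\<mu> \<in> carrier_vec n" and "j < n"
  shows "\<gamma> * (transpose_mat (closed_loop_matrix n P c) *\<^sub>v \<mu>) $ j = (\<Sum>i<n. K (c i) i j * \<mu> $ i)"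
proof -
  have "transpose_mat (closed_loop_matrix n P c) \<in> carrier_mat n n"
    by (simp add: closed_loop_matrix_def)
  from mult_mat_vec_sum[OF this assms] show ?thesis
    using assms(2) by (simp add: closed_loop_matrix_def K_def sum_distrib_left mult.assoc
        del: index_mult_mat_vec)
qed

lemma closed_loop_equation_iff:
  assumes "\<mu> \<in> carrier_vec n"
  shows "\<gamma> \<cdot>\<^sub>v (transpose_mat (closed_loop_matrix n P c) *\<^sub>v \<mu>) - \<mu> = - m \<longleftrightarrow>
    (\<forall>j<n. \<mu> $ j = (\<Sum>i<n. K (c i) i j * \<mu> $ i) + m $ j)"
proof -
  have dim: "dim_row (transpose_mat (closed_loop_matrix n P c)) = n"
    by (simp add: closed_loop_matrix_def)
  have "\<gamma> \<cdot>\<^sub>v (transpose_mat (closed_loop_matrix n P c) *\<^sub>v \<mu>) - \<mu> = - m \<longleftrightarrow>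
      (\<forall>j<n. \<gamma> * (transpose_mat (closed_loop_matrix n P c) *\<^sub>v \<mu>) $ j - \<mu> $ j = - m $ j)"
    using assms m_carrier dim by (auto simp: vec_eq_iff simp del: index_mult_mat_vec)
  also have "\<dots> \<longleftrightarrow> (\<forall>j<n. \<mu> $ j = (\<Sum>i<n. K (c i) i j * \<mu> $ i) + m $ j)"
    using closed_loop_index[OF assms] by (auto simp: algebra_simps)
  finally show ?thesis .
qed

text \<open>The occupation vector solves the equation, and stability of the transposed closed loop
  excludes any other solution.\<close>

lemma closed_loop_unique_solution:
  assumes st: "stable n (\<lambda>j. K (c j) j)"
  shows "\<exists>!\<mu>. \<mu> \<in> carrier_vec n \<and>
    \<gamma> \<cdot>\<^sub>v (transpose_mat (closed_loop_matrix n P c) *\<^sub>v \<mu>) - \<mu> = - m"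
proof (rule ex1I[of _ "vec n (occupation c)"], goal_cases)
  case 1
  then show ?case
    using occupation_eq[OF st] by (simp add: closed_loop_equation_iff)
next
  case (2 \<mu>)
  then have "\<mu> $ j = occupation c j" if "j < n" for j
    using occupation_eq[OF st] that
    by (intro stable_unique[OF stable_transpose[OF st]]) (auto simp: closed_loop_equation_iff)
  then show ?case using 2 by (intro eq_vecI) auto
qed

text \<open>Nonnegativity comes from stability, and the strict decrease in each entry is the
  positive supply \<open>m\<close>, divided by \<open>\<gamma>\<close>.\<close>

lemma closed_loop_lyapunov:
  assumes st: "stable n (\<lambda>j. K (c j) j)" and \<mu>: "\<mu> \<in> carrier_vec n"
    and eq: "\<gamma> \<cdot>\<^sub>v (transpose_mat (closed_loop_matrix n P c) *\<^sub>v \<mu>) - \<mu> = - m"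
  shows "lyapunov_measure n \<gamma> (closed_loop_matrix n P c) \<mu>"
proof -
  have flow: "\<mu> $ j = (\<Sum>i<n. K (c i) i j * \<mu> $ i) + m $ j" if "j < n" for j
    using eq that by (simp add: closed_loop_equation_iff[OF \<mu>])
  have "0 \<le> \<mu> $ j" if "j < n" for j
    using m_pos by (intro stable_solution_nonneg[OF stable_transpose[OF st] flow _ that])
      (auto intro: less_imp_le)
  moreover have "(transpose_mat (closed_loop_matrix n P c) *\<^sub>v \<mu>) $ j < inverse \<gamma> * \<mu> $ j"
    if "j < n" for j
    using closed_loop_index[OF \<mu> that, of c] flow[OF that] m_pos[OF that] \<gamma>_pos
    by (simp add: field_simps del: index_mult_mat_vec)
  ultimately show ?thesis
    using \<mu> by (simp add: lyapunov_measure_def less_eq_vec_def del: index_mult_mat_vec)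
qed

end

theorem theorem15:
  fixes X A :: "'a::euclidean_space set"
    and U :: "'b::euclidean_space set"
    and T :: "'a \<times> 'b \<Rightarrow> 'a"
    and N M :: nat
    and D :: "nat \<Rightarrow> 'a set"
    and u :: "nat \<Rightarrow> 'b"
    and P :: "nat \<Rightarrow> real mat"
    and G :: "nat \<Rightarrow> real vec"
    and m :: "real vec"
    and \<gamma> :: real
  assumes "compact X" and "compact U"
    and "T \<in> X \<times> U \<rightarrow> X" and "T \<in> borel_measurable (restrict_space borel (X \<times> U))"
    and "0 < N" and "cell_partition X N D"
    and "A \<subseteq> X" and "A \<subseteq> D (N - 1)"
    and "\<forall>a<M. u a \<in> U"
    and P: "\<forall>a<M. P a = sub_markov_matrix (\<lambda>x. T (x, u a)) D N"
    and "m \<in> carrier_vec (N - 1)" and "\<forall>j<N - 1. 0 < m $ j"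
    and "\<forall>a<M. G a \<in> carrier_vec (N - 1) \<and> (\<forall>j<N - 1. 0 < G a $ j)"
    and "1 < \<gamma>"
    and feasible: "\<exists>\<theta>. primal_feasible (N - 1) M \<gamma> P m \<theta>"
  shows "(\<exists>\<theta>. primal_optimal (N - 1) M \<gamma> P G m \<theta> \<and>
            (\<exists>B. \<forall>a<M. \<forall>j<N - 1. \<bar>\<theta> a $ j\<bar> \<le> B)) \<and>
         (\<exists>V. dual_optimal (N - 1) M \<gamma> P G m V \<and> (\<exists>B. \<forall>j<N - 1. \<bar>V $ j\<bar> \<le> B)) \<and>
         (\<forall>\<theta>. primal_optimal (N - 1) M \<gamma> P G m \<theta> \<longrightarrow>
            (\<forall>j<N - 1. {a. a < M \<and> 0 < \<theta> a $ j} \<noteq> {}) \<and>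
            (let c = (\<lambda>j. Min {a. a < M \<and> 0 < \<theta> a $ j});
                 Pu = closed_loop_matrix (N - 1) P c
             in optimal_control (N - 1) M \<gamma> P G m c \<and>
                (\<exists>!\<mu>. \<mu> \<in> carrier_vec (N - 1) \<and>
                      \<gamma> \<cdot>\<^sub>v (transpose_mat Pu *\<^sub>v \<mu>) - \<mu> = - m) \<and>
                (\<forall>\<mu>. \<mu> \<in> carrier_vec (N - 1) \<and>
                      \<gamma> \<cdot>\<^sub>v (transpose_mat Pu *\<^sub>v \<mu>) - \<mu> = - m \<longrightarrow>
                      lyapunov_measure (N - 1) \<gamma> Pu \<mu>)))"
proof -
  \<comment> \<open>The entries of \<open>P a\<close> are quotients of values of
    \<open>measure\<close>, hence nonnegative.\<close>
  interpret control_lp "N - 1" M \<gamma> P G m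
  proof
    fix a assume "a < M"
    then show "P a \<in> carrier_mat (N - 1) (N - 1)"
      using P by (simp add: sub_markov_matrix_def)
    fix j i assume "j < N - 1" "i < N - 1"
    then show "0 \<le> P a $$ (j, i)"
      using P \<open>a < M\<close> by (simp add: sub_markov_matrix_def transition_matrix_def)
  qed (use assms in auto)
  \<comment> \<open>Only finitely many entries are involved, so the sum of their absolute values is
    a bound.\<close>
  have bounded: "\<exists>B. \<forall>a<M. \<forall>j<N - 1. \<bar>\<theta> a $ j\<bar> \<le> B" for \<theta> :: "nat \<Rightarrow> real vec"
  proof -
    have "\<bar>\<theta> a $ j\<bar> \<le> (\<Sum>a<M. \<Sum>j<N - 1. \<bar>\<theta> a $ j\<bar>)" if "a < M" "j < N - 1" for a j
      using that by (intro order_trans[OF member_le_sum[of j "{..<N - 1}"] member_le_sum[of a "{..<M}"]])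
        (auto intro: sum_nonneg)
    then show ?thesis by blast
  qed
  have bounded_vec: "\<exists>B. \<forall>j<N - 1. \<bar>V $ j\<bar> \<le> B" for V :: "real vec"
    by (rule exI[of _ "\<Sum>j<N - 1. \<bar>V $ j\<bar>"]) (auto intro: member_le_sum)
  obtain \<theta>\<^sub>0 where \<theta>\<^sub>0: "primal_feasible (N - 1) M \<gamma> P m \<theta>\<^sub>0"
    using feasible by blast
  have support: "{a. a < M \<and> 0 < \<theta> a $ j} \<noteq> {}"
    if "primal_optimal (N - 1) M \<gamma> P G m \<theta>" "j < N - 1" for \<theta> j
  proof
    assume "{a. a < M \<and> 0 < \<theta> a $ j} = {}"
    then have "(\<Sum>a<M. \<theta> a $ j) \<le> 0"
      by (intro sum_nonpos) force
    with total_mass_pos[of \<theta> j] that show False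
      by (simp add: primal_optimal_def)
  qed
  show ?thesis
  proof (intro conjI allI impI, unfold Let_def)
    show "\<exists>\<theta>. primal_optimal (N - 1) M \<gamma> P G m \<theta> \<and> (\<exists>B. \<forall>a<M. \<forall>j<N - 1. \<bar>\<theta> a $ j\<bar> \<le> B)"
      using primal_optimal_exists[OF \<theta>\<^sub>0] bounded by blast
    show "\<exists>V. dual_optimal (N - 1) M \<gamma> P G m V \<and> (\<exists>B. \<forall>j<N - 1. \<bar>V $ j\<bar> \<le> B)"
      using dual_optimal_exists[OF \<theta>\<^sub>0] bounded_vec by blast
  next
    fix \<theta> j assume "primal_optimal (N - 1) M \<gamma> P G m \<theta>" "j < N - 1"
    then show "{a. a < M \<and> 0 < \<theta> a $ j} \<noteq> {}" by (rule support)
  next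
    fix \<theta> assume opt: "primal_optimal (N - 1) M \<gamma> P G m \<theta>"
    define c where "c = (\<lambda>j. Min {a. a < M \<and> 0 < \<theta> a $ j})"
    \<comment> \<open>The least index is a selection from the support, as
      \<open>support_policy\<close> requires.\<close>
    have c: "c j < M \<and> 0 < \<theta> (c j) $ j" if "j < N - 1" for j
      using Min_in[OF _ support[OF opt that]] by (auto simp: c_def)
    note stable = support_policy(1)[of \<theta> c, OF opt c]
    show "optimal_control (N - 1) M \<gamma> P G m (\<lambda>j. Min {a. a < M \<and> 0 < \<theta> a $ j}) \<and>
      (\<exists>!\<mu>. \<mu> \<in> carrier_vec (N - 1) \<and>
        \<gamma> \<cdot>\<^sub>v (transpose_mat (closed_loop_matrix (N - 1) P (\<lambda>j. Min {a. a < M \<and> 0 < \<theta> a $ j})) *\<^sub>v \<mu>)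
          - \<mu> = - m) \<and>
      (\<forall>\<mu>. \<mu> \<in> carrier_vec (N - 1) \<and>
        \<gamma> \<cdot>\<^sub>v (transpose_mat (closed_loop_matrix (N - 1) P (\<lambda>j. Min {a. a < M \<and> 0 < \<theta> a $ j})) *\<^sub>v \<mu>)
          - \<mu> = - m \<longrightarrow>
        lyapunov_measure (N - 1) \<gamma> (closed_loop_matrix (N - 1) P
          (\<lambda>j. Min {a. a < M \<and> 0 < \<theta> a $ j})) \<mu>)"
      unfolding c_def[symmetric]
      using support_policy(2)[of \<theta> c, OF opt c] closed_loop_unique_solution[OF stable]
        closed_loop_lyapunov[OF stable] by blast
  qed
qed

end
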